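(* For $\alpha\in(-\infty,0)$, $$C(1,\alpha)=\begin{cases}2 & \text{for }\alpha\in(-1,0),\\[2pt] \dfrac{1}{2^{1/\alpha}} & \text{for }\alpha\in(-\infty,-1].\end{cases}$$
   Context: For $\alpha\in(-\infty,0)$, $a,b\in[0,\infty]$ and $t\in[0,1]$, the mean of order $\alpha$ is $M_\alpha(a,b;t)=\left(ta^\alpha+(1-t)b^\alpha\right)^{1/\alpha}$ if $a\ne0$ and $b\ne0$ (with the conventions $\infty^\alpha=0$ and $0^{1/\alpha}=\infty$; in particular $M_\alpha(\infty,c;\tfrac12)=M_\alpha(c,\infty;\tfrac12)=c/2^{1/\alpha}$ and $M_\alpha(\infty,\infty;t)=\infty$), and $M_\alpha(a,b;t)=0$ if either $a=0$ or $b=0$. A function $f:\mathbf{R}\to[0,\infty]$ is $\alpha$-concave if $f(tx+(1-t)y)\ge M_\alpha(f(x),f(y);t)$ for all $x,y\in\mathbf{R}$ and all $t\in[0,1]$. The difference function of order $\alpha$ of $f:\mathbf{R}\to[0,\infty]$ is $$\Delta_\alpha f(z)=\sup\left\{M_\alpha\left(f(x),f(-y);\tfrac12\right)\;:\;x,y\in\mathbf{R},\ \tfrac12(x+y)=z\right\},\quad z\in\mathbf{R}.$$ The constant is $$C(1,\alpha)=\sup\left\{\frac{\int_{\mathbf{R}}\Delta_\alpha f\,dz}{\int_{\mathbf{R}}f\,dx}\;:\;f:\mathbf{R}\to[0,\infty]\ \text{is }\alpha\text{-concave},\ 0<\int_{\mathbf{R}}f\,dx<\infty\right\}.$$ *)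

theory Defs
  imports "HOL-Analysis.Analysis"
begin

text \<open>Powers of extended nonnegative numbers with negative exponent \<open>p < 0\<close>, following the
  conventions \<open>\<infinity>\<close> to the \<open>p\<close> equals \<open>0\<close> and \<open>0\<close> to the \<open>p\<close> equals \<open>\<infinity>\<close>. The case distinction
  is needed because \<open>0 powr p = 0\<close> and \<open>enn2real \<infinity> = 0\<close> in the library.\<close>

definition ennpow_neg :: "ennreal \<Rightarrow> real \<Rightarrow> ennreal" where
  "ennpow_neg x p =
     (if x = 0 then \<infinity> else if x = \<infinity> then 0 else ennreal (enn2real x powr p))"

definition mean_order :: "real \<Rightarrow> ennreal \<Rightarrow> ennreal \<Rightarrow> real \<Rightarrow> ennreal" where
  "mean_order \<alpha> a b t =
     (if a = 0 \<or> b = 0 then 0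
      else ennpow_neg (ennreal t * ennpow_neg a \<alpha> + ennreal (1 - t) * ennpow_neg b \<alpha>) (1 / \<alpha>))"

definition alpha_concave :: "real \<Rightarrow> (real \<Rightarrow> ennreal) \<Rightarrow> bool" where
  "alpha_concave \<alpha> f \<longleftrightarrow>
     (\<forall>x y. \<forall>t\<in>{0..1}. f (t * x + (1 - t) * y) \<ge> mean_order \<alpha> (f x) (f y) t)"

definition difference_function :: "real \<Rightarrow> (real \<Rightarrow> ennreal) \<Rightarrow> real \<Rightarrow> ennreal" where
  "difference_function \<alpha> f z =
     Sup {mean_order \<alpha> (f x) (f (- y)) (1 / 2) | x y. (1 / 2) * (x + y) = z}"

text \<open>No measurability hypothesis is needed below: for \<open>\<alpha> < 0\<close>, the superlevel sets of an
  \<open>\<alpha>\<close>-concave function on the line are intervals, so such a function is Borel measurable, and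
  the difference function of an \<open>\<alpha>\<close>-concave function is again \<open>\<alpha>\<close>-concave.\<close>

definition difference_constant :: "real \<Rightarrow> ennreal" where
  "difference_constant \<alpha> =
     Sup {(\<integral>\<^sup>+ z. difference_function \<alpha> f z \<partial>lborel) / (\<integral>\<^sup>+ x. f x \<partial>lborel) | f.
            alpha_concave \<alpha> f \<and> 0 < (\<integral>\<^sup>+ x. f x \<partial>lborel) \<and> (\<integral>\<^sup>+ x. f x \<partial>lborel) < \<infinity>}"

end

theory Submission
  imports Defs "HOL-Real_Asymp.Real_Asymp"
begin

text \<open>
  The difference function at \<open>z\<close> compares \<open>f x\<close> and \<open>f y\<close> over all pairs with \<open>x - y = 2 z\<close>. If the
  mean \<open>M\<close> of \<open>f x\<close> and \<open>f y\<close> exceeds \<open>s\<close>, then so does \<open>f\<close> at the midpoint of \<open>x\<close> and \<open>y\<close>, by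
  \<open>\<alpha>\<close>-concavity, and at one of the endpoints. Since \<open>{f > s}\<close> is an interval, its length is at
  least \<open>\<bar>z\<bar>\<close>, and integrating over the levels \<open>s\<close> gives the bound \<open>2\<close>. With
  \<open>K = 2 powr (- 1 / \<alpha>)\<close> one has \<open>M \<le> K * min (f x) (f y)\<close>; hence if \<open>M > K * s\<close>, both endpoints
  lie in \<open>{f > s}\<close>, its length is at least \<open>2 * \<bar>z\<bar>\<close>, and the bound \<open>K\<close> results.

  For sharpness take \<open>f x = (x + c) powr (1 / \<alpha>)\<close> on an interval \<open>I\<close> with left endpoint \<open>0\<close>; the pairs
  \<open>(2 z, 0)\<close> and \<open>(0, 2 z)\<close> show that the difference function at \<open>z\<close> is at least \<open>f \<bar>z\<bar>\<close> if
  \<open>2 * \<bar>z\<bar>\<close> lies in \<open>I\<close>. One uses \<open>c = 1\<close>, \<open>I = [0, \<infinity>)\<close> if \<open>- 1 < \<alpha>\<close>, then \<open>c = 0\<close>, \<open>I = [0, 1]\<close> if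
  \<open>\<alpha> < - 1\<close>, and \<open>c = 1\<close>, \<open>I = [0, L]\<close> with \<open>L \<rightarrow> \<infinity>\<close> if \<open>\<alpha> = - 1\<close>.
\<close>

section \<open>Negative powers and means of extended nonnegative numbers\<close>

lemma ennpow_neg_antimono:
  assumes "p < 0" "x \<le> y"
  shows "ennpow_neg y p \<le> ennpow_neg x p"
proof (cases "x = 0 \<or> y = top")
  case True
  then show ?thesis
    using assms by (auto simp: ennpow_neg_def)
next
  case False
  then obtain r s where "x = ennreal r" "y = ennreal s" "0 < r" "r \<le> s"
    using assms(2) by (cases x; cases y) (auto simp: top_unique order_less_le)
  then show ?thesis
    using assms(1) by (auto simp: ennpow_neg_def intro!: ennreal_leI powr_mono2')
qed

text \<open>The conventions at 0 and infinity exchange these two values, so the powers cancel there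
  as well.\<close>

lemma ennpow_neg_inverse:
  assumes "p < 0"
  shows "ennpow_neg (ennpow_neg x p) (1 / p) = x"
  using assms by (cases x) (auto simp: ennpow_neg_def powr_powr order_less_le)

lemma ennpow_neg_cmult:
  assumes "0 < c"
  shows "ennpow_neg (ennreal c * x) p = ennreal (c powr p) * ennpow_neg x p"
proof (cases x)
  case (real r)
  show ?thesis
  proof (cases "r = 0")
    case True
    then show ?thesis
      using real assms by (simp add: ennpow_neg_def ennreal_mult_top)
  next
    case False
    have "ennreal c * x = ennreal (c * r)"
      using real assms by (simp add: ennreal_mult)
    moreover have "ennpow_neg (ennreal (c * r)) p = ennreal ((c * r) powr p)"
      using real assms False by (auto simp: ennpow_neg_def)
    moreover have "ennpow_neg x p = ennreal (r powr p)"
      using real False by (auto simp: ennpow_neg_def)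
    ultimately show ?thesis
      using real assms by (simp add: powr_mult ennreal_mult)
  qed
next
  case top
  then show ?thesis
    using assms by (simp add: ennpow_neg_def ennreal_mult_top)
qed

lemma mean_order_sym: "mean_order \<alpha> a b (1 / 2) = mean_order \<alpha> b a (1 / 2)"
  by (auto simp: mean_order_def add.commute)

text \<open>A negative power reverses the order, so the weighted sum of powers is at most the power
  of the minimum; the outer power reverses the order again.\<close>

lemma min_le_mean_order:
  assumes "\<alpha> < 0" "t \<in> {0..1}"
  shows "min a b \<le> mean_order \<alpha> a b t"
proof (cases "a = 0 \<or> b = 0")
  case False
  define m where "m = ennpow_neg (min a b) \<alpha>"
  have "ennreal t * ennpow_neg a \<alpha> + ennreal (1 - t) * ennpow_neg b \<alpha>
      \<le> ennreal t * m + ennreal (1 - t) * m"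
    unfolding m_def using assms(1)
    by (intro add_mono mult_left_mono ennpow_neg_antimono) auto
  also have "\<dots> = m"
    using assms(2) by (simp flip: distrib_right ennreal_plus)
  finally have "ennpow_neg m (1 / \<alpha>) \<le> mean_order \<alpha> a b t"
    using False assms(1) by (auto simp: mean_order_def intro!: ennpow_neg_antimono)
  then show ?thesis
    using assms(1) by (simp add: m_def ennpow_neg_inverse)
qed auto

lemma mean_order_le_max:
  assumes "\<alpha> < 0" "t \<in> {0..1}"
  shows "mean_order \<alpha> a b t \<le> max a b"
proof (cases "a = 0 \<or> b = 0")
  case True
  then show ?thesis by (auto simp: mean_order_def)
next
  case False
  define m where "m = ennpow_neg (max a b) \<alpha>"
  have "m = ennreal t * m + ennreal (1 - t) * m"
    using assms(2) by (simp flip: distrib_right ennreal_plus)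
  also have "\<dots> \<le> ennreal t * ennpow_neg a \<alpha> + ennreal (1 - t) * ennpow_neg b \<alpha>"
    unfolding m_def using assms(1)
    by (intro add_mono mult_left_mono ennpow_neg_antimono) auto
  finally have "mean_order \<alpha> a b t \<le> ennpow_neg m (1 / \<alpha>)"
    using False assms(1) by (auto simp: mean_order_def intro!: ennpow_neg_antimono)
  then show ?thesis
    using assms(1) by (simp add: m_def ennpow_neg_inverse)
qed

text \<open>Dropping the term of \<open>b\<close> shrinks the sum, hence enlarges its negative
  power; the remaining factor 1/2 comes out as the constant.\<close>

lemma mean_order_half_le:
  assumes "\<alpha> < 0"
  shows "mean_order \<alpha> a b (1 / 2) \<le> ennreal (1 / 2 powr (1 / \<alpha>)) * a"
proof (cases "a = 0 \<or> b = 0")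
  case True
  then show ?thesis by (auto simp: mean_order_def)
next
  case False
  have "mean_order \<alpha> a b (1 / 2) \<le> ennpow_neg (ennreal (1 / 2) * ennpow_neg a \<alpha>) (1 / \<alpha>)"
    using False assms by (auto simp: mean_order_def intro!: ennpow_neg_antimono)
  also have "\<dots> = ennreal ((1 / 2) powr (1 / \<alpha>)) * a"
    using assms by (subst ennpow_neg_cmult) (auto simp: ennpow_neg_inverse)
  finally show ?thesis by (simp add: powr_divide)
qed

section \<open>Quasi-concavity and measurability\<close>

lemma alpha_concave_min_le:
  assumes "\<alpha> < 0" "alpha_concave \<alpha> f" "x \<le> u" "u \<le> y"
  shows "min (f x) (f y) \<le> f u"
proof -
  \<comment> \<open>With the endpoints in this order, the segment parameter is the weight of
    \<open>x\<close>.\<close>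
  have "u \<in> closed_segment y x"
    using assms(3,4) by (simp add: closed_segment_eq_real_ivl)
  then obtain t where t: "t \<in> {0..1}" "u = t * x + (1 - t) * y"
    by (auto simp: in_segment algebra_simps)
  have "min (f x) (f y) \<le> mean_order \<alpha> (f x) (f y) t"
    using assms(1) t(1) by (rule min_le_mean_order)
  also have "\<dots> \<le> f u"
    using assms(2) t unfolding alpha_concave_def by blast
  finally show ?thesis .
qed

lemma alpha_concave_borel_measurable:
  assumes "\<alpha> < 0" "alpha_concave \<alpha> f"
  shows "f \<in> borel_measurable borel"
proof (rule borel_measurableI_greater)
  fix s
  have "is_interval {x. s < f x}"
    unfolding is_interval_1
  proof (intro ballI allI impI)
    fix a b x
    assume "a \<in> {x. s < f x}" "b \<in> {x. s < f x}" "a \<le> x \<and> x \<le> b"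
    then show "x \<in> {x. s < f x}"
      using alpha_concave_min_le[OF assms, of a x b]
      by (auto intro: less_le_trans[of s "min (f a) (f b)"])
  qed
  then have "{x. s < f x} \<in> sets borel"
    by (rule real_interval_borel_measurable)
  then show "{x \<in> space borel. s < f x} \<in> sets borel" by simp
qed

section \<open>Comparison of integrals through superlevel sets\<close>

lemma nn_integral_layer_cake:
  assumes [measurable]: "f \<in> borel_measurable borel"
  shows "(\<integral>\<^sup>+ x. f x \<partial>lborel)
    = (\<integral>\<^sup>+ s. emeasure lborel {x. ennreal s < f x} * indicator {0..} s \<partial>lborel)"
proof -
  \<comment> \<open>Each value of \<open>f\<close> is the length of the set of levels below it;
    Tonelli then exchanges levels and points.\<close>
  have slice: "(\<integral>\<^sup>+ s. indicator {s. 0 \<le> s \<and> ennreal s < a} s \<partial>lborel) = a" for a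
  proof (cases a)
    case (real r)
    then have "{s. 0 \<le> s \<and> ennreal s < a} = {0..<r}"
      by (auto simp: ennreal_less_iff)
    with real show ?thesis by simp
  next
    case top
    then have "{s. 0 \<le> s \<and> ennreal s < a} = {0..}"
      by auto
    moreover have "emeasure lborel {0::real..} = top"
    proof (rule ccontr)
      assume "emeasure lborel {0::real..} \<noteq> top"
      then obtain r where r: "0 \<le> r" "emeasure lborel {0::real..} = ennreal r"
        by (cases "emeasure lborel {0::real..}") auto
      have "emeasure lborel {0..r + 1} \<le> emeasure lborel {0::real..}"
        by (rule emeasure_mono) auto
      with r show False by (simp del: ennreal_plus)
    qed
    ultimately show ?thesis
      using top by simp
  qed
  have "(\<integral>\<^sup>+ x. f x \<partial>lborel)
      = (\<integral>\<^sup>+ x. \<integral>\<^sup>+ s. indicator {s. 0 \<le> s \<and> ennreal s < f x} s \<partial>lborel \<partial>lborel)"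
    by (simp add: slice)
  also have "\<dots> = (\<integral>\<^sup>+ x. \<integral>\<^sup>+ s. indicator {p. 0 \<le> snd p \<and> ennreal (snd p) < f (fst p)} (x, s)
      \<partial>lborel \<partial>lborel)"
    by (simp add: indicator_def)
  also have "\<dots> = (\<integral>\<^sup>+ s. \<integral>\<^sup>+ x. indicator {p. 0 \<le> snd p \<and> ennreal (snd p) < f (fst p)} (x, s)
      \<partial>lborel \<partial>lborel)"
    by (rule lborel_pair.Fubini') measurable
  also have "\<dots> = (\<integral>\<^sup>+ s. \<integral>\<^sup>+ x. indicator {x. ennreal s < f x} x * indicator {0..} s
      \<partial>lborel \<partial>lborel)"
    by (intro nn_integral_cong) (auto simp: indicator_def)
  also have "\<dots> = (\<integral>\<^sup>+ s. emeasure lborel {x. ennreal s < f x} * indicator {0..} s \<partial>lborel)"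
    by (intro nn_integral_cong) (subst nn_integral_multc, auto)
  finally show ?thesis .
qed

text \<open>No measurability of \<open>g\<close> is needed, since the integral is a supremum over simple functions
  below \<open>g\<close>.\<close>

lemma nn_integral_le_if_superlevel_le:
  fixes f g :: "real \<Rightarrow> ennreal"
  assumes f: "f \<in> borel_measurable borel"
    and le: "\<And>s z. 0 \<le> s \<Longrightarrow> ennreal s < g z \<Longrightarrow>
      ennreal \<bar>z\<bar> \<le> ennreal c * emeasure lborel {x. ennreal s < f x}"
    and "0 \<le> c"
  shows "(\<integral>\<^sup>+ z. g z \<partial>lborel) \<le> ennreal (2 * c) * (\<integral>\<^sup>+ x. f x \<partial>lborel)"
  unfolding nn_integral_def[of lborel g]
proof (rule SUP_least)
  fix h :: "real \<Rightarrow> ennreal"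
  assume "h \<in> {h. simple_function lborel h \<and> h \<le> g}"
  then have sf: "simple_function lborel h" and hg: "\<And>z. h z \<le> g z"
    by (auto simp: le_fun_def)
  from sf have h[measurable]: "h \<in> borel_measurable borel"
    by (auto dest: borel_measurable_simple_function)
  note f[measurable]
  \<comment> \<open>The hypothesis confines the level set of \<open>h\<close> to an interval
    symmetric about 0 whose radius is \<open>c\<close> times the measure of the level set of
    \<open>f\<close>, whence the factor \<open>2 * c\<close>.\<close>
  have level: "emeasure lborel {z. ennreal s < h z}
      \<le> ennreal (2 * c) * emeasure lborel {x. ennreal s < f x}" if "0 \<le> s" for s
  proof (cases "ennreal c * emeasure lborel {x. ennreal s < f x}")
    case (real r)
    have "{z. ennreal s < h z} \<subseteq> {-r..r}"
    proof
      fix z assume "z \<in> {z. ennreal s < h z}"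
      then have "ennreal s < g z"
        using hg[of z] by (auto intro: less_le_trans)
      from le[OF that this] have "\<bar>z\<bar> \<le> r"
        using real by simp
      then show "z \<in> {-r..r}" by auto
    qed
    then have "emeasure lborel {z. ennreal s < h z} \<le> emeasure lborel {-r..r}"
      by (rule emeasure_mono) simp
    also have "\<dots> = ennreal 2 * (ennreal c * emeasure lborel {x. ennreal s < f x})"
      using real by (simp flip: ennreal_mult ennreal_numeral)
    finally show ?thesis
      using \<open>0 \<le> c\<close> by (simp add: ennreal_mult mult.assoc)
  next
    case top
    then show ?thesis
      using \<open>0 \<le> c\<close> by (simp add: ennreal_mult mult.assoc ennreal_mult_top)
  qed
  have "integral\<^sup>S lborel h = (\<integral>\<^sup>+ z. h z \<partial>lborel)"
    using sf by (simp add: nn_integral_eq_simple_integral)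
  also have "\<dots> = (\<integral>\<^sup>+ s. emeasure lborel {z. ennreal s < h z} * indicator {0..} s \<partial>lborel)"
    by (rule nn_integral_layer_cake) measurable
  also have "\<dots> \<le> (\<integral>\<^sup>+ s. ennreal (2 * c) *
      (emeasure lborel {x. ennreal s < f x} * indicator {0..} s) \<partial>lborel)"
    using level by (intro nn_integral_mono) (auto simp: indicator_def)
  also have "\<dots> = ennreal (2 * c) * (\<integral>\<^sup>+ x. f x \<partial>lborel)"
    by (subst nn_integral_layer_cake[of f]) (auto intro!: nn_integral_cmult)
  finally show "integral\<^sup>S lborel h \<le> ennreal (2 * c) * (\<integral>\<^sup>+ x. f x \<partial>lborel)" .
qed

section \<open>Upper bounds for the integral of the difference function\<close>

lemma alpha_concave_dist_le_superlevel:
  assumes "\<alpha> < 0" "alpha_concave \<alpha> f" "s < f x" "s < f y"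
  shows "ennreal \<bar>x - y\<bar> \<le> emeasure lborel {u. s < f u}"
proof -
  have sub: "{min x y..max x y} \<subseteq> {u. s < f u}"
  proof
    fix u assume u: "u \<in> {min x y..max x y}"
    have "s < min (f (min x y)) (f (max x y))"
      using assms(3,4) by (auto simp: min_def max_def)
    also have "\<dots> \<le> f u"
      using u by (intro alpha_concave_min_le[OF assms(1,2)]) auto
    finally show "u \<in> {u. s < f u}" by simp
  qed
  have "ennreal \<bar>x - y\<bar> = emeasure lborel {min x y..max x y}"
    by (auto simp: min_def max_def abs_if)
  also have "\<dots> \<le> emeasure lborel {u. s < f u}"
    using sub alpha_concave_borel_measurable[OF assms(1,2)]
    by (intro emeasure_mono) measurable
  finally show ?thesis .
qed

text \<open>The supremum need not be attained, but a strict lower level is exceeded by some pair.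
  Flipping the sign of \<open>y\<close> turns the midpoint condition into one on the
  difference.\<close>

lemma less_difference_functionE:
  assumes "s < difference_function \<alpha> f z"
  obtains x y where "x - y = 2 * z" "s < mean_order \<alpha> (f x) (f y) (1 / 2)"
proof -
  obtain x y where "s < mean_order \<alpha> (f x) (f (- y)) (1 / 2)" "(1 / 2) * (x + y) = z"
    using assms unfolding difference_function_def less_Sup_iff by blast
  with that[of x "- y"] show ?thesis by auto
qed

lemma nn_integral_difference_function_le_two:
  assumes "\<alpha> < 0" "alpha_concave \<alpha> f"
  shows "(\<integral>\<^sup>+ z. difference_function \<alpha> f z \<partial>lborel) \<le> 2 * (\<integral>\<^sup>+ x. f x \<partial>lborel)"
proof -
  have key: "ennreal \<bar>z\<bar> \<le> emeasure lborel {x. s < f x}"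
    if gt: "s < difference_function \<alpha> f z" for s z
  proof -
    obtain x y where xy: "x - y = 2 * z" "s < mean_order \<alpha> (f x) (f y) (1 / 2)"
      using gt by (rule less_difference_functionE)
    have "mean_order \<alpha> (f x) (f y) t \<le> f (t * x + (1 - t) * y)" if "t \<in> {0..1}" for t
      using assms(2) that unfolding alpha_concave_def by blast
    from this[of "1 / 2"] have mid: "s < f ((x + y) / 2)"
      using xy(2) by (simp add: field_simps)
    \<comment> \<open>An endpoint above the level and the midpoint are at distance
      \<open>\<bar>z\<bar>\<close>, half that of the endpoints.\<close>
    have "s < max (f x) (f y)"
      using xy(2) mean_order_le_max[OF assms(1), of "1 / 2" "f x" "f y"] by auto
    then show ?thesis
    proof (cases "s < f x")
      case True
      have "\<bar>x - (x + y) / 2\<bar> = \<bar>z\<bar>"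
        using xy(1) by (simp add: field_simps)
      then show ?thesis
        using alpha_concave_dist_le_superlevel[OF assms True mid] by simp
    next
      case False
      then have "s < f y"
        using \<open>s < max (f x) (f y)\<close> by (auto simp: less_max_iff_disj)
      moreover have "\<bar>(x + y) / 2 - y\<bar> = \<bar>z\<bar>"
        using xy(1) by (simp add: field_simps)
      ultimately show ?thesis
        using alpha_concave_dist_le_superlevel[OF assms mid] by metis
    qed
  qed
  show ?thesis
    using nn_integral_le_if_superlevel_le[OF alpha_concave_borel_measurable[OF assms],
        of "difference_function \<alpha> f" 1] key
    by simp
qed

lemma nn_integral_difference_function_le_powr:
  assumes "\<alpha> < 0" "alpha_concave \<alpha> f"
  shows "(\<integral>\<^sup>+ z. difference_function \<alpha> f z \<partial>lborel)
    \<le> ennreal (1 / 2 powr (1 / \<alpha>)) * (\<integral>\<^sup>+ x. f x \<partial>lborel)"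
proof -
  define K where "K = 1 / 2 powr (1 / \<alpha>)"
  have K: "0 < K" by (simp add: K_def)
  note [measurable] = alpha_concave_borel_measurable[OF assms]
  \<comment> \<open>This trades the level \<open>s\<close> of \<open>K * f\<close> for the level
    \<open>s / K\<close> of \<open>f\<close>, whose superlevel sets are known to be
    intervals.\<close>
  have scale: "ennreal s < ennreal K * a \<longleftrightarrow> ennreal (s / K) < a" if "0 \<le> s" for s a
    using K that
    by (cases a) (auto simp: ennreal_mult_top ennreal_less_iff field_simps simp flip: ennreal_mult)
  \<comment> \<open>The factor 1/2 cancels the 2 of the comparison lemma, so that only
    \<open>K\<close> is left.\<close>
  have key: "ennreal \<bar>z\<bar> \<le> ennreal (1 / 2) * emeasure lborel {x. ennreal s < ennreal K * f x}"
    if "0 \<le> s" and gt: "ennreal s < difference_function \<alpha> f z" for s z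
  proof -
    obtain x y where xy: "x - y = 2 * z" "ennreal s < mean_order \<alpha> (f x) (f y) (1 / 2)"
      using gt by (rule less_difference_functionE)
    have "ennreal s < ennreal K * f x" "ennreal s < ennreal K * f y"
      using xy(2) mean_order_half_le[OF assms(1), of "f x" "f y"]
        mean_order_half_le[OF assms(1), of "f y" "f x"]
      by (auto simp: K_def mean_order_sym intro: less_le_trans)
    then have "ennreal (2 * \<bar>z\<bar>) \<le> emeasure lborel {x. ennreal s < ennreal K * f x}"
      using alpha_concave_dist_le_superlevel[OF assms, of "ennreal (s / K)" x y] xy(1)
      by (simp add: scale[OF \<open>0 \<le> s\<close>] abs_mult)
    then have "ennreal (1 / 2) * ennreal (2 * \<bar>z\<bar>)
        \<le> ennreal (1 / 2) * emeasure lborel {x. ennreal s < ennreal K * f x}"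
      by (rule mult_left_mono) simp
    moreover have "ennreal (1 / 2) * ennreal (2 * \<bar>z\<bar>) = ennreal \<bar>z\<bar>"
      by (subst ennreal_mult[symmetric]) auto
    ultimately show ?thesis by (simp only:)
  qed
  have "(\<integral>\<^sup>+ z. difference_function \<alpha> f z \<partial>lborel)
      \<le> ennreal (2 * (1 / 2)) * (\<integral>\<^sup>+ x. ennreal K * f x \<partial>lborel)"
    using key by (intro nn_integral_le_if_superlevel_le) auto
  also have "\<dots> = ennreal K * (\<integral>\<^sup>+ x. f x \<partial>lborel)"
    by (simp add: nn_integral_cmult)
  finally show ?thesis by (simp add: K_def)
qed

lemma difference_constant_le:
  assumes "\<And>f. alpha_concave \<alpha> f \<Longrightarrow>
    (\<integral>\<^sup>+ z. difference_function \<alpha> f z \<partial>lborel) \<le> C * (\<integral>\<^sup>+ x. f x \<partial>lborel)"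
  shows "difference_constant \<alpha> \<le> C"
  unfolding difference_constant_def
proof (rule Sup_least, clarify)
  fix f :: "real \<Rightarrow> ennreal"
  assume f: "alpha_concave \<alpha> f" "0 < (\<integral>\<^sup>+ x. f x \<partial>lborel)" "(\<integral>\<^sup>+ x. f x \<partial>lborel) < \<infinity>"
  then show "(\<integral>\<^sup>+ z. difference_function \<alpha> f z \<partial>lborel) / (\<integral>\<^sup>+ x. f x \<partial>lborel) \<le> C"
    using assms[OF f(1)] by (intro divide_le_posI_ennreal) (auto simp: mult.commute)
qed

section \<open>Test functions and lower bounds\<close>

text \<open>For \<open>c = 0 \<in> I\<close> the value at \<open>0\<close> is \<open>\<infinity>\<close>, whereas \<open>powr\<close> would give the junk value \<open>0\<close>.\<close>

definition ray_power :: "real \<Rightarrow> real \<Rightarrow> real set \<Rightarrow> real \<Rightarrow> ennreal" where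
  "ray_power \<alpha> c I x = (if x \<in> I then ennpow_neg (ennreal (x + c)) (1 / \<alpha>) else 0)"

text \<open>The power \<alpha> undoes \<open>1 / \<alpha>\<close>, so the mean becomes a convex
  combination of the bases.\<close>

lemma mean_order_ennpow_neg:
  assumes "\<alpha> < 0" "0 \<le> u" "0 \<le> v" "t \<in> {0..1}"
  shows "mean_order \<alpha> (ennpow_neg (ennreal u) (1 / \<alpha>)) (ennpow_neg (ennreal v) (1 / \<alpha>)) t
    = ennpow_neg (ennreal (t * u + (1 - t) * v)) (1 / \<alpha>)"
proof -
  have nz: "ennpow_neg (ennreal w) (1 / \<alpha>) \<noteq> 0" if "0 \<le> w" for w
    using that by (auto simp: ennpow_neg_def)
  have inv: "ennpow_neg (ennpow_neg w (1 / \<alpha>)) \<alpha> = w" for w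
    using ennpow_neg_inverse[of "1 / \<alpha>" w] assms(1) by simp
  show ?thesis
    using assms nz by (simp add: mean_order_def inv flip: ennreal_mult ennreal_plus)
qed

text \<open>On \<open>I\<close> the base is affine in the point, which gives equality; a point
  outside \<open>I\<close> has value 0 and makes the mean 0.\<close>

lemma alpha_concave_ray_power:
  assumes "\<alpha> < 0" "0 \<le> c" "I \<subseteq> {0..}" "convex I"
  shows "alpha_concave \<alpha> (ray_power \<alpha> c I)"
  unfolding alpha_concave_def
proof (intro allI ballI)
  fix x y t :: real
  assume t: "t \<in> {0..1}"
  show "mean_order \<alpha> (ray_power \<alpha> c I x) (ray_power \<alpha> c I y) t
      \<le> ray_power \<alpha> c I (t * x + (1 - t) * y)"
  proof (cases "x \<in> I \<and> y \<in> I")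
    case True
    then have "t * x + (1 - t) * y \<in> I"
      using convexD[OF assms(4), of x y t "1 - t"] t by auto
    moreover have "t * (x + c) + (1 - t) * (y + c) = t * x + (1 - t) * y + c"
      by (simp add: algebra_simps)
    moreover have "0 \<le> x + c" "0 \<le> y + c"
      using True assms(2,3) by auto
    ultimately show ?thesis
      using True mean_order_ennpow_neg[OF assms(1) _ _ t, of "x + c" "y + c"]
      by (simp add: ray_power_def)
  next
    case False
    then show ?thesis by (auto simp: ray_power_def mean_order_def)
  qed
qed

lemma ray_power_le_difference_function:
  assumes "\<alpha> < 0" "0 \<le> c" "0 \<in> I" "2 * \<bar>z\<bar> \<in> I"
  shows "ennpow_neg (ennreal (\<bar>z\<bar> + c)) (1 / \<alpha>) \<le> difference_function \<alpha> (ray_power \<alpha> c I) z"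
proof -
  let ?f = "ray_power \<alpha> c I"
  have eq: "mean_order \<alpha> (?f (2 * \<bar>z\<bar>)) (?f 0) (1 / 2) = ennpow_neg (ennreal (\<bar>z\<bar> + c)) (1 / \<alpha>)"
  proof -
    have "(1 / 2) * (2 * \<bar>z\<bar> + c) + (1 - 1 / 2) * c = \<bar>z\<bar> + c"
      by (simp add: field_simps)
    then show ?thesis
      using assms mean_order_ennpow_neg[of \<alpha> "2 * \<bar>z\<bar> + c" c "1 / 2"]
      by (simp add: ray_power_def del: ennreal_plus)
  qed
  have "\<exists>x y. mean_order \<alpha> (?f (2 * \<bar>z\<bar>)) (?f 0) (1 / 2) = mean_order \<alpha> (?f x) (?f (- y)) (1 / 2)
      \<and> (1 / 2) * (x + y) = z"
  \<comment> \<open>The sign of \<open>z\<close> decides which of the two arguments sits at 0; the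
    mean is symmetric.\<close>
  proof (cases "0 \<le> z")
    case True
    then show ?thesis by (intro exI[of _ "2 * z"] exI[of _ 0]) simp
  next
    case False
    then show ?thesis
      by (intro exI[of _ 0] exI[of _ "2 * z"]) (simp add: mean_order_sym)
  qed
  then show ?thesis
    unfolding eq[symmetric] difference_function_def by (intro Sup_upper) blast
qed

lemma nn_integral_difference_function_ray_power_ge:
  assumes "\<alpha> < 0" "0 \<le> c" "convex I" "I \<subseteq> {0..}" "0 \<in> I" "J \<subseteq> {0..}" "J \<in> sets borel"
    and J: "\<And>z. z \<in> J \<Longrightarrow> 2 * z \<in> I"
  shows "2 * (\<integral>\<^sup>+ x. ennreal ((x + c) powr (1 / \<alpha>)) * indicator J x \<partial>lborel)
    \<le> (\<integral>\<^sup>+ z. difference_function \<alpha> (ray_power \<alpha> c I) z \<partial>lborel)"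
proof -
  \<comment> \<open>Without the point 0, \<open>g\<close> vanishes on the nonpositive half-line, so
    \<open>g z\<close> and \<open>g (- z)\<close> are never both positive and their sum stays below
    the difference function.\<close>
  define g where "g x = ennreal ((x + c) powr (1 / \<alpha>)) * indicator (J - {0}) x" for x
  note [measurable] = \<open>J \<in> sets borel\<close>
  have [measurable]: "g \<in> borel_measurable borel"
    unfolding g_def by measurable
  have g_le: "g \<bar>z\<bar> \<le> difference_function \<alpha> (ray_power \<alpha> c I) z" for z
  proof (cases "\<bar>z\<bar> \<in> J - {0}")
    case True
    then have "g \<bar>z\<bar> = ennpow_neg (ennreal (\<bar>z\<bar> + c)) (1 / \<alpha>)"
      using \<open>0 \<le> c\<close> by (auto simp: g_def ennpow_neg_def simp del: ennreal_plus)
    also have "\<dots> \<le> difference_function \<alpha> (ray_power \<alpha> c I) z"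
      using True assms by (intro ray_power_le_difference_function) auto
    finally show ?thesis .
  qed (simp add: g_def)
  have g0: "g x = 0" if "x \<le> 0" for x
    using that \<open>J \<subseteq> {0..}\<close> by (auto simp: g_def indicator_def)
  have sum_le: "g z + g (- z) \<le> difference_function \<alpha> (ray_power \<alpha> c I) z" for z
    using g_le[of z] g0[of z] g0[of "- z"] by (cases "0 \<le> z") auto
  have "(\<integral>\<^sup>+ x. ennreal ((x + c) powr (1 / \<alpha>)) * indicator J x \<partial>lborel) = (\<integral>\<^sup>+ x. g x \<partial>lborel)"
    using AE_lborel_singleton[of 0]
    by (intro nn_integral_cong_AE) (auto simp: g_def indicator_def elim!: eventually_mono)
  moreover have "(\<integral>\<^sup>+ x. g x \<partial>lborel) = (\<integral>\<^sup>+ x. g (- x) \<partial>lborel)"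
    using nn_integral_real_affine[of g "-1" 0] by simp
  ultimately have "2 * (\<integral>\<^sup>+ x. ennreal ((x + c) powr (1 / \<alpha>)) * indicator J x \<partial>lborel)
      = (\<integral>\<^sup>+ x. g x + g (- x) \<partial>lborel)"
    by (simp add: nn_integral_add mult_2)
  also have "\<dots> \<le> (\<integral>\<^sup>+ z. difference_function \<alpha> (ray_power \<alpha> c I) z \<partial>lborel)"
    by (intro nn_integral_mono sum_le)
  finally show ?thesis .
qed

lemma nn_integral_ray_power:
  assumes "0 \<le> c" "I \<subseteq> {0..}"
  shows "(\<integral>\<^sup>+ x. ray_power \<alpha> c I x \<partial>lborel)
    = (\<integral>\<^sup>+ x. ennreal ((x + c) powr (1 / \<alpha>)) * indicator I x \<partial>lborel)"
proof (rule nn_integral_cong_AE)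
  show "AE x in lborel. ray_power \<alpha> c I x = ennreal ((x + c) powr (1 / \<alpha>)) * indicator I x"
    using AE_lborel_singleton[of 0]
  proof eventually_elim
    case (elim x)
    then show ?case
      using assms
      by (cases "x \<in> I")
        (auto simp: ray_power_def ennpow_neg_def subset_iff simp del: ennreal_plus)
  qed
qed

text \<open>The test function has integral \<open>A\<close>, and each half-line contributes at least
  \<open>B\<close> to the integral of its difference function.\<close>

lemma difference_constant_ge:
  assumes "\<alpha> < 0" "0 \<le> c" "convex I" "I \<subseteq> {0..}" "0 \<in> I" "J \<subseteq> {0..}" "J \<in> sets borel"
    and J: "\<And>z. z \<in> J \<Longrightarrow> 2 * z \<in> I"
    and I_int: "(\<integral>\<^sup>+ x. ennreal ((x + c) powr (1 / \<alpha>)) * indicator I x \<partial>lborel) = ennreal A"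
    and J_int: "(\<integral>\<^sup>+ x. ennreal ((x + c) powr (1 / \<alpha>)) * indicator J x \<partial>lborel) = ennreal B"
    and "0 < A" "0 \<le> B"
  shows "ennreal (2 * B / A) \<le> difference_constant \<alpha>"
proof -
  let ?f = "ray_power \<alpha> c I"
  have conc: "alpha_concave \<alpha> ?f"
    using assms by (intro alpha_concave_ray_power) auto
  have A: "(\<integral>\<^sup>+ x. ?f x \<partial>lborel) = ennreal A"
    using assms by (simp add: nn_integral_ray_power)
  have "ennreal (2 * B) \<le> (\<integral>\<^sup>+ z. difference_function \<alpha> ?f z \<partial>lborel)"
    using nn_integral_difference_function_ray_power_ge[OF assms(1-8)] J_int \<open>0 \<le> B\<close>
    by (simp add: ennreal_mult)
  then have "ennreal (2 * B / A)
      \<le> (\<integral>\<^sup>+ z. difference_function \<alpha> ?f z \<partial>lborel) / (\<integral>\<^sup>+ x. ?f x \<partial>lborel)"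
    using \<open>0 < A\<close> \<open>0 \<le> B\<close> unfolding A
    by (subst divide_ennreal[symmetric]) (auto intro: divide_right_mono_ennreal)
  also have "\<dots> \<le> difference_constant \<alpha>"
    unfolding difference_constant_def using conc A \<open>0 < A\<close>
    by (intro Sup_upper CollectI exI[of _ ?f]) auto
  finally show ?thesis .
qed

section \<open>Sharpness in the three ranges of the order\<close>

lemma difference_constant_ge_two:
  assumes "-1 < \<alpha>" "\<alpha> < 0"
  shows "2 \<le> difference_constant \<alpha>"
proof -
  define p where "p = 1 / \<alpha>"
  have p: "p < -1"
    using assms by (simp add: p_def field_simps)
  have "((\<lambda>x. (x + 1) powr (p + 1) / (p + 1)) \<longlongrightarrow> 0) at_top"
    using p by real_asymp
  then have "(\<integral>\<^sup>+ x. ennreal ((x + 1) powr p) * indicator {0..} x \<partial>lborel)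
      = ennreal (0 - (0 + 1) powr (p + 1) / (p + 1))"
    using p by (intro nn_integral_FTC_atLeast) (auto intro!: derivative_eq_intros)
  then have int: "(\<integral>\<^sup>+ x. ennreal ((x + 1) powr (1 / \<alpha>)) * indicator {0..} x \<partial>lborel)
      = ennreal (- 1 / (p + 1))"
    by (simp add: p_def)
  \<comment> \<open>The ray is closed under doubling, so \<open>I\<close> and \<open>J\<close>
    coincide and the two integrals cancel.\<close>
  have "ennreal (2 * (- 1 / (p + 1)) / (- 1 / (p + 1))) \<le> difference_constant \<alpha>"
    using p assms(2) int
    by (intro difference_constant_ge[of \<alpha> 1 "{0..}" "{0..}"]) (auto simp: divide_neg_neg)
  moreover have "2 * (- 1 / (p + 1)) / (- 1 / (p + 1)) = 2"
    using p by (intro nonzero_mult_div_cancel_right) auto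
  ultimately have "ennreal 2 \<le> difference_constant \<alpha>"
    by metis
  then show ?thesis by simp
qed

text \<open>Here the singularity at 0 is integrable, and halving the interval scales the integral by
  \<open>(1 / 2) powr (p + 1)\<close>.\<close>

lemma difference_constant_ge_powr:
  assumes "\<alpha> < -1"
  shows "ennreal (1 / 2 powr (1 / \<alpha>)) \<le> difference_constant \<alpha>"
proof -
  define p where "p = 1 / \<alpha>"
  have p: "-1 < p"
    using assms by (simp add: p_def field_simps)
  have int: "(\<integral>\<^sup>+ x. ennreal ((x + 0) powr (1 / \<alpha>)) * indicator {0..b} x \<partial>lborel)
      = ennreal (b powr (p + 1) / (p + 1))" if "0 \<le> b" for b
    using nn_integral_has_integral_lebesgue[OF _ has_integral_powr_from_0[of p b]] p that
    by (simp add: p_def ennreal_mult'' ennreal_indicator mult.commute)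
  have "ennreal (2 * ((1 / 2) powr (p + 1) / (p + 1)) / (1 powr (p + 1) / (p + 1)))
      \<le> difference_constant \<alpha>"
    using p assms int[of 1] int[of "1 / 2"]
    by (intro difference_constant_ge[of \<alpha> 0 "{0..1}" "{0..1/2}"]) (auto simp: p_def)
  moreover have "2 * ((1 / 2) powr (p + 1) / (p + 1)) / (1 powr (p + 1) / (p + 1)) = 1 / 2 powr p"
    using p by (simp add: powr_divide powr_add)
  ultimately show ?thesis by (simp add: p_def)
qed

text \<open>The reciprocal is integrable neither at 0 nor at infinity, so it is shifted and
  truncated; halving \<open>L\<close> does not affect the logarithm to leading order.\<close>

lemma difference_constant_minus_one_ge: "2 \<le> difference_constant (-1)"
proof (rule tendsto_upperbound)
  have int: "(\<integral>\<^sup>+ x. ennreal ((x + 1) powr (1 / (-1))) * indicator {0..b} x \<partial>lborel)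
      = ennreal (ln (b + 1))" if "0 \<le> b" for b :: real
  proof -
    have "(\<integral>\<^sup>+ x. ennreal ((x + 1) powr (1 / (-1))) * indicator {0..b} x \<partial>lborel)
        = ennreal (ln (b + 1) - ln (0 + 1))"
      using that
      by (intro nn_integral_FTC_Icc) (auto intro!: derivative_eq_intros simp: powr_minus field_simps)
    then show ?thesis by simp
  qed
  show "\<forall>\<^sub>F L in at_top. ennreal (2 * ln (L / 2 + 1) / ln (L + 1)) \<le> difference_constant (-1)"
    using eventually_gt_at_top[of 0]
  proof eventually_elim
    case (elim L)
    then show ?case
      using int[of L] int[of "L / 2"]
      by (intro difference_constant_ge[of "-1" 1 "{0..L}" "{0..L/2}"]) auto
  qed
  have "((\<lambda>L::real. 2 * ln (L / 2 + 1) / ln (L + 1)) \<longlongrightarrow> 2) at_top"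
    by real_asymp
  then have "((\<lambda>L::real. ennreal (2 * ln (L / 2 + 1) / ln (L + 1))) \<longlongrightarrow> ennreal 2) at_top"
    by (rule tendsto_ennrealI)
  then show "((\<lambda>L::real. ennreal (2 * ln (L / 2 + 1) / ln (L + 1))) \<longlongrightarrow> 2) at_top"
    by simp
qed simp

theorem mainTheorem8:
  fixes \<alpha> :: real
  assumes "\<alpha> < 0"
  shows "difference_constant \<alpha> =
    (if -1 < \<alpha> then 2 else ennreal (1 / 2 powr (1 / \<alpha>)))"
proof (cases "-1 < \<alpha>")
  case True
  have "difference_constant \<alpha> = 2"
    using difference_constant_le[of \<alpha> 2] nn_integral_difference_function_le_two[OF assms]
      difference_constant_ge_two[OF True assms]
    by (intro antisym) auto
  with True show ?thesis by simp
next
  case False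
  have "ennreal (1 / 2 powr (1 / \<alpha>)) \<le> difference_constant \<alpha>"
  \<comment> \<open>At the borderline order the constant \<open>1 / 2 powr (1 / \<alpha>)\<close>
    equals 2.\<close>
  proof (cases "\<alpha> = -1")
    case True
    then show ?thesis
      using difference_constant_minus_one_ge by (simp add: powr_minus)
  next
    case neq: False
    with False show ?thesis by (intro difference_constant_ge_powr) simp
  qed
  then have "difference_constant \<alpha> = ennreal (1 / 2 powr (1 / \<alpha>))"
    using difference_constant_le nn_integral_difference_function_le_powr[OF assms]
    by (intro antisym) auto
  with False show ?thesis by simp
qed

end
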